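(* For $n\geq 1$ let $$s_n(x)=(-1)^{n+1}(1+x)(1-x^2)^{\lfloor (n-1)/2\rfloor},\qquad r_n(x)=(-1)^{n-1}(x-1)(1-x^2)^{\lfloor (n-1)/2\rfloor}.$$ Then for every $n\geq 1$: (1) $S_{n+1}(x)=\det(m_{i,j})_{1\leq i,j\leq n}$, a lower Hessenberg determinant of order $n$, where $m_{i,1}=x\,s_i(x)$ for $1\leq i\leq n$, $m_{i,j}=\binom{i}{j-1}s_{i-j+1}(x)$ for $2\leq j\leq i\leq n$, $m_{i,i+1}=-1$ for $1\leq i\leq n-1$, and $m_{i,j}=0$ for $j>i+1$. (2) $R_{n+1}(x)=\det(p_{i,j})_{0\leq i,j\leq n}$, a lower Hessenberg determinant of order $n+1$, where $p_{0,0}=1$, $p_{i,0}=r_i(x)$ for $1\leq i\leq n$, $p_{i,j}=\binom{i}{j-1}s_{i-j+1}(x)$ for $1\leq j\leq i\leq n$, $p_{i,i+1}=-1$ for $0\leq i\leq n-1$, and $p_{i,j}=0$ for $j>i+1$.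
   Context: For $\pi=\pi(1)\cdots\pi(n)$ in the symmetric group $\mathfrak{S}_n$, an alternating run is a maximal segment of consecutive entries (of length at least two) that is increasing or decreasing; $\mathrm{run}(\pi)$ is the number of alternating runs (so $\mathrm{run}=0$ when $n=1$). The type $A$ alternating run polynomials are $R_n(x)=\sum_{\pi\in\mathfrak{S}_n}x^{\mathrm{run}(\pi)}$ for $n\ge 1$ (so $R_1(x)=1$, $R_2(x)=2x$, $R_3(x)=2x+4x^2$). The up-down run polynomials are $S_n(x)=\sum_{\pi\in\mathfrak{S}_n}x^{\mathrm{as}(\pi)}$, where $\mathrm{as}(\pi)$ is the number of alternating runs of the word $0\,\pi(1)\cdots\pi(n)$ (equivalently, the maximal length $k$ of a subsequence with $\pi(i_1)>\pi(i_2)<\pi(i_3)>\cdots\pi(i_k)$, $i_1<\cdots<i_k$); $S_0(x)=1$, $S_1(x)=x$, $S_2(x)=x+x^2$. *)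

theory Defs
  imports
    "HOL-Combinatorics.Multiset_Permutations"
    "HOL-Computational_Algebra.Polynomial"
    "Jordan_Normal_Form.Determinant"
begin

definition monotone_segment :: "nat list \<Rightarrow> nat \<Rightarrow> nat \<Rightarrow> bool" where
  "monotone_segment w i j \<longleftrightarrow> i < j \<and> j < length w \<and>
     (strict_mono_on {i..j} (\<lambda>k. w ! k) \<or> strict_antimono_on {i..j} (\<lambda>k. w ! k))"

text \<open>An alternating run is represented by the pair of its first and last position, counted from 0.\<close>

definition alternating_runs :: "nat list \<Rightarrow> (nat \<times> nat) set" where
  "alternating_runs w = {(i, j). monotone_segment w i j \<and>
     (\<forall>i' j'. monotone_segment w i' j' \<and> i' \<le> i \<and> j \<le> j' \<longrightarrow> i' = i \<and> j' = j)}"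

definition num_runs :: "nat list \<Rightarrow> nat" where
  "num_runs w = card (alternating_runs w)"

definition up_down_runs :: "nat list \<Rightarrow> nat" where
  "up_down_runs w = num_runs (0 # w)"

text \<open>The permutations of \<open>{1..n}\<close> are taken in one-line notation: \<^const>\<open>permutations_of_set\<close>
  is the set of all words containing each element exactly once.\<close>

definition run_poly :: "nat \<Rightarrow> int poly" where
  "run_poly n = (\<Sum>w\<in>permutations_of_set {1..n}. monom 1 (num_runs w))"

definition up_down_run_poly :: "nat \<Rightarrow> int poly" where
  "up_down_run_poly n = (\<Sum>w\<in>permutations_of_set {1..n}. monom 1 (up_down_runs w))"

abbreviation X :: "int poly" where
  "X \<equiv> [:0, 1:]"

text \<open>Both families are only used for \<open>n \<ge> 1\<close>, where \<open>(n - 1) div 2\<close> is the floor of the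
  rational number and the subtraction does not truncate.\<close>

definition s_poly :: "nat \<Rightarrow> int poly" where
  "s_poly n = (-1) ^ (n + 1) * (1 + X) * (1 - X\<^sup>2) ^ ((n - 1) div 2)"

definition r_poly :: "nat \<Rightarrow> int poly" where
  "r_poly n = (-1) ^ (n - 1) * (X - 1) * (1 - X\<^sup>2) ^ ((n - 1) div 2)"

text \<open>Entries with row and column indices \<open>i, j \<ge> 1\<close>; the subscript is written
  \<open>i + 1 - j\<close> to avoid truncation.\<close>

definition m_entry :: "nat \<Rightarrow> nat \<Rightarrow> int poly" where
  "m_entry i j =
     (if j = 1 then X * s_poly i
      else if j \<le> i then of_nat (i choose (j - 1)) * s_poly (i + 1 - j)
      else if j = i + 1 then -1
      else 0)"

text \<open>Entries with row and column indices starting at 0.\<close>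

definition p_entry :: "nat \<Rightarrow> nat \<Rightarrow> int poly" where
  "p_entry i j =
     (if j = 0 then (if i = 0 then 1 else r_poly i)
      else if j \<le> i then of_nat (i choose (j - 1)) * s_poly (i + 1 - j)
      else if j = i + 1 then -1
      else 0)"

end

theory Submission
  imports Defs
begin

text \<open>Expanding a lower Hessenberg determinant with superdiagonal \<open>-1\<close> along its last row expresses it
  by its leading principal minors \<open>D\<^sub>k\<close>, as \<open>D\<^sub>n\<^sub>+\<^sub>1 = \<Sum>k\<le>n. a n k * D\<^sub>k\<close> without signs
  (\<open>det_lower_hessenberg_Suc\<close>). The theorem therefore says that the polynomials satisfy, for \<open>n \<ge> 1\<close>,
  the binomial convolutions
  \<open>S\<^sub>n\<^sub>+\<^sub>1 = \<Sum>k<n. (n choose k) * s\<^sub>n\<^sub>-\<^sub>k * S\<^sub>k\<^sub>+\<^sub>1\<close> and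
  \<open>R\<^sub>n\<^sub>+\<^sub>1 = r\<^sub>n + (\<Sum>k<n. (n choose k) * s\<^sub>n\<^sub>-\<^sub>k * R\<^sub>k\<^sub>+\<^sub>1)\<close>.

  Inserting a new maximum into a word of length \<open>L\<close> with \<open>k\<close> alternating runs keeps the number of
  runs at \<open>k\<close> places, raises it by 1 at two places and by 2 at the remaining \<open>L - 1 - k\<close>
  (\<open>sum_num_runs_insert_max\<close>). If the word has a leading 0 that must stay in front, one of
  the two places that raise it by 1 is lost. With \<open>D p = x * (1 - x\<^sup>2) * p'\<close> these counts are the recurrences
  \<open>S\<^sub>n\<^sub>+\<^sub>1 = (n * x\<^sup>2 + x) * S\<^sub>n + D S\<^sub>n\<close> and \<open>R\<^sub>n\<^sub>+\<^sub>2 = (n * x\<^sup>2 + 2 * x) * R\<^sub>n\<^sub>+\<^sub>1 + D R\<^sub>n\<^sub>+\<^sub>1\<close>.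

  The polynomials \<open>s\<^sub>n\<close> and \<open>r\<^sub>n\<close> satisfy recurrences of the same form
  (\<open>signed_power_recurrence\<close>). Since \<open>D\<close> is a derivation, applying it to a convolution of solutions
  yields the next convolution (\<open>binomial_convolution_of_derivation_recurrence\<close>), so that the
  convolution identities follow by induction on \<open>n\<close>.\<close>

section \<open>Alternating runs and changes of direction\<close>

definition ascent_at :: "nat list \<Rightarrow> nat \<Rightarrow> bool" where
  "ascent_at w k \<longleftrightarrow> w ! k < w ! Suc k"

lemma monotone_on_interval_iff_steps:
  assumes "transp R"
  shows "monotone_on {i..j} (<) R f \<longleftrightarrow> (\<forall>k\<in>{i..<j}. R (f k) (f (Suc k)))"
proof
  assume steps: "\<forall>k\<in>{i..<j}. R (f k) (f (Suc k))"
  have "R (f a) (f b)" if "a < b" "i \<le> a" "b \<le> j" for a b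
    using that
  proof (induction a b rule: less_Suc_induct)
    case (1 k)
    then show ?case using steps by auto
  next
    case (2 k l m)
    then have "R (f k) (f l)" "R (f l) (f m)" by auto
    then show ?case using assms by (blast dest: transpD)
  qed
  then show "monotone_on {i..j} (<) R f"
    by (auto simp: monotone_on_def)
qed (auto simp: monotone_on_def)

text \<open>In a word without repetitions every step either ascends or descends, so the two kinds of
  monotone segments become one: the direction bits of its steps are constant.\<close>

lemma monotone_segment_iff_constant_direction:
  assumes "distinct w"
  shows "monotone_segment w i j \<longleftrightarrow>
    i < j \<and> j < length w \<and> (\<exists>d. \<forall>k\<in>{i..<j}. ascent_at w k = d)"
proof -
  have "(\<forall>k\<in>{i..<j}. w ! Suc k < w ! k) \<longleftrightarrow> (\<forall>k\<in>{i..<j}. ascent_at w k = False)"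
    if "j < length w"
  proof (rule ball_cong[OF refl])
    fix k assume "k \<in> {i..<j}"
    then have "w ! k \<noteq> w ! Suc k"
      using assms that by (simp add: nth_eq_iff_index_eq)
    then show "w ! Suc k < w ! k \<longleftrightarrow> ascent_at w k = False"
      by (auto simp: ascent_at_def)
  qed
  then show ?thesis
    unfolding monotone_segment_def ex_bool_eq
      monotone_on_interval_iff_steps[OF transp_on_less]
      monotone_on_interval_iff_steps[OF transp_on_greater]
    by (auto simp only: ascent_at_def simp_thms)
qed

definition run_starts :: "nat list \<Rightarrow> nat set" where
  "run_starts w = {i. Suc i < length w \<and> (i = 0 \<or> ascent_at w (i - 1) \<noteq> ascent_at w i)}"

text \<open>A run is determined by its first position, since of two segments with the same first
  position one contains the other. A segment that starts inside a stretch of constant direction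
  can be prolonged to the left; conversely the longest segment from a position where the direction
  has just changed (or from position 0) is maximal.\<close>

lemma num_runs_eq_card_run_starts:
  assumes "distinct w"
  shows "num_runs w = card (run_starts w)"
proof -
  note seg = monotone_segment_iff_constant_direction[OF assms]
  have run_segment: "monotone_segment w i j" if "(i, j) \<in> alternating_runs w" for i j
    using that by (simp add: alternating_runs_def)
  have run_maximal: "i' = i \<and> j' = j"
    if "(i, j) \<in> alternating_runs w" "monotone_segment w i' j'" "i' \<le> i" "j \<le> j'" for i j i' j'
    using that by (simp add: alternating_runs_def)
  have same_start: "j = j'" if "(i, j) \<in> alternating_runs w" "(i, j') \<in> alternating_runs w" for i j j'
  proof (cases "j \<le> j'")
    case True
    then show ?thesis using run_maximal[OF that(1) run_segment[OF that(2)]] by simp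
  next
    case False
    then show ?thesis using run_maximal[OF that(2) run_segment[OF that(1)]] by simp
  qed
  have inj: "inj_on fst (alternating_runs w)"
    by (rule inj_onI) (auto dest: same_start)
  have image: "fst ` alternating_runs w = run_starts w"
  proof (intro equalityI subsetI)
    fix i assume "i \<in> fst ` alternating_runs w"
    then obtain j where ij: "(i, j) \<in> alternating_runs w" by force
    then have s: "monotone_segment w i j" by (rule run_segment)
    have "ascent_at w (i - 1) \<noteq> ascent_at w i" if "i \<noteq> 0"
    proof
      assume eq: "ascent_at w (i - 1) = ascent_at w i"
      have "ascent_at w k = ascent_at w i" if "k \<in> {i - 1..<j}" for k
        using s that eq unfolding seg by (cases "k = i - 1") auto
      then have "\<exists>d. \<forall>k\<in>{i - 1..<j}. ascent_at w k = d"
        by blast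
      moreover have "i - 1 < j" "j < length w" using s unfolding seg by auto
      ultimately have "monotone_segment w (i - 1) j"
        unfolding seg by blast
      then show False using run_maximal[OF ij, of "i - 1" j] \<open>i \<noteq> 0\<close> by simp
    qed
    then show "i \<in> run_starts w" using s by (auto simp: run_starts_def seg)
  next
    fix i assume i: "i \<in> run_starts w"
    \<comment> \<open>The run that starts at \<open>i\<close> ends as far to the right as possible.\<close>
    define J where "J = {j. monotone_segment w i j}"
    have fin: "finite J" by (rule finite_subset[of _ "{..<length w}"]) (auto simp: J_def seg)
    have "Suc i \<in> J" using i by (auto simp: J_def seg run_starts_def)
    then have "Max J \<in> J" using fin by (intro Max_in) auto
    then have m: "monotone_segment w i (Max J)" by (simp add: J_def)
    have "(i, Max J) \<in> alternating_runs w"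
      unfolding alternating_runs_def mem_Collect_eq case_prod_conv
    proof (rule conjI[OF m], rule allI, rule allI, rule impI)
      fix i' j' assume a: "monotone_segment w i' j' \<and> i' \<le> i \<and> Max J \<le> j'"
      then have "\<exists>d. \<forall>k\<in>{i'..<j'}. ascent_at w k = d"
        by (simp only: seg)
      then obtain d where d: "\<forall>k\<in>{i'..<j'}. ascent_at w k = d" ..
      have "i < Max J" using m by (simp add: seg)
      have "\<not> i' < i"
      proof
        assume "i' < i"
        then have "i' \<le> i - 1" "i - 1 < j'" "i' \<le> i" "i < j'"
          using a \<open>i < Max J\<close> by linarith+
        then have "ascent_at w (i - 1) = ascent_at w i"
          using bspec[OF d, of "i - 1"] bspec[OF d, of i] by simp
        then show False using i \<open>i' < i\<close> by (simp add: run_starts_def)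
      qed
      then have "i' = i" using a by simp
      then have "j' \<in> J" using a by (simp add: J_def)
      then have "j' \<le> Max J" by (rule Max_ge[OF fin])
      then show "i' = i \<and> j' = Max J" using a \<open>i' = i\<close> by simp
    qed
    then show "i \<in> fst ` alternating_runs w" by (rule image_eqI[rotated]) simp
  qed
  show ?thesis
    unfolding num_runs_def image[symmetric] by (rule card_image[OF inj, symmetric])
qed

text \<open>The bit \<open>d\<close> is the direction of the step that led to the first letter (\<^const>\<open>True\<close> for an
  ascent), so a change at the first letter is counted too. This makes the count recursive along the
  word.\<close>

fun direction_changes :: "bool \<Rightarrow> nat list \<Rightarrow> nat" where
  "direction_changes d (a # b # w) =
     of_bool ((a < b) \<noteq> d) + direction_changes (a < b) (b # w)"
| "direction_changes d [a] = 0"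
| "direction_changes d [] = 0"

lemma direction_changes_eq_sum:
  "direction_changes d (a # w) =
    (\<Sum>i<length w. of_bool (ascent_at (a # w) i \<noteq> (if i = 0 then d else ascent_at (a # w) (i - 1))))"
proof (induction w arbitrary: a d)
  case (Cons b w)
  have "ascent_at (a # b # w) (Suc i - 1) = (if i = 0 then a < b else ascent_at (b # w) (i - 1))" for i
    by (cases i) (auto simp: ascent_at_def)
  moreover have "ascent_at (a # b # w) (Suc i) = ascent_at (b # w) i" for i
    by (simp add: ascent_at_def)
  ultimately show ?case
    using Cons.IH[of "a < b" b]
    by (simp add: sum.lessThan_Suc_shift ascent_at_def del: sum.lessThan_Suc)
qed simp

text \<open>Pretend that the word is entered by a step in the direction opposite to its first step:
  then position 0 counts as a change, and the run starts are exactly the changes.\<close>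

lemma num_runs_Cons_Cons:
  assumes "distinct (a # b # w)"
  shows "num_runs (a # b # w) = Suc (direction_changes (a < b) (b # w))"
proof -
  define changes where "changes = {..<length (b # w)} \<inter> {i. ascent_at (a # b # w) i \<noteq>
    (if i = 0 then \<not> a < b else ascent_at (a # b # w) (i - 1))}"
  have "num_runs (a # b # w) = card (run_starts (a # b # w))"
    by (rule num_runs_eq_card_run_starts[OF assms])
  also have "run_starts (a # b # w) = changes"
    by (auto simp: run_starts_def changes_def ascent_at_def[of _ 0])
  also have "card changes = direction_changes (\<not> a < b) (a # b # w)"
    unfolding direction_changes_eq_sum changes_def
    by (simp only: sum_of_bool_eq finite_lessThan of_nat_id)
  also have "\<dots> = Suc (direction_changes (a < b) (b # w))"
    by simp
  finally show ?thesis .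
qed

lemma num_runs_singleton: "num_runs [a] = 0"
  by (simp add: num_runs_eq_card_run_starts run_starts_def)

text \<open>After the leading 0 the word must ascend, so entering the 0 by a descent counts the first run
  as a change.\<close>

lemma up_down_runs_eq_direction_changes:
  assumes "distinct w" "0 \<notin> set w"
  shows "up_down_runs w = direction_changes False (0 # w)"
proof (cases w)
  case (Cons e u)
  then show ?thesis
    using assms by (auto simp: up_down_runs_def num_runs_Cons_Cons)
qed (simp add: up_down_runs_def num_runs_singleton)

section \<open>Inserting a new maximum\<close>

lemma sum_direction_changes_insert_Cons:
  fixes x :: "'a::comm_semiring_1"
  assumes "b < M" "e < M"
  shows "(\<Sum>p\<le>length (e # w). x ^ direction_changes d (b # take p (e # w) @ M # drop p (e # w)))
    = x ^ (of_bool (\<not> d) + 1 + direction_changes False (e # w))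
      + x ^ of_bool ((b < e) \<noteq> d) *
       (\<Sum>p\<le>length w. x ^ direction_changes (b < e) (e # take p w @ M # drop p w))"
proof -
  have "direction_changes d (b # M # e # w) = of_bool (\<not> d) + 1 + direction_changes False (e # w)"
    using assms by auto
  then show ?thesis
    unfolding length_Cons sum.atMost_Suc_shift
    by (simp add: power_add sum_distrib_left)
qed

text \<open>Inserting a new maximum adds 0, 1 or 2 changes. When \<open>b\<close> is entered by a descent, the
  insertion leaves the count as it is at \<open>c\<close> places and adds 1 at a single place: at the end of the
  word if it arrives there by a descent, and otherwise before the last letter. At all other places
  it adds 2. When \<open>b\<close> is entered by an ascent and followed by a descent, the places are distributed
  in the same way. If an ascent follows instead, one more place leaves the count unchanged and one
  fewer adds 2; if \<open>b\<close> is the last letter, the only place leaves it unchanged. The last summand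
  is this correction. The induction needs both values of \<open>d\<close>, because the
  first step of the word determines how the rest is entered.\<close>

lemma sum_direction_changes_insert_max:
  fixes x :: "'a::comm_ring_1"
  assumes "\<forall>a\<in>set (b # w). a < M"
  shows "(\<Sum>p\<le>length w. x ^ direction_changes d (b # take p w @ M # drop p w)) =
    (let c = direction_changes d (b # w); l = length w in
      of_nat c * x ^ c + x ^ (c + 1) + (of_nat l - of_nat c) * x ^ (c + 2)
      + (if \<not> d then 0
         else if w = [] then 1 - x
         else of_bool (b < hd w) * (x ^ c - x ^ (c + 2))))"
  using assms
proof (induction w arbitrary: b d)
  case Nil
  then show ?case by simp
next
  case (Cons e w)
  then have "b < M" "e < M" "\<forall>a\<in>set (e # w). a < M" by auto
  note step = sum_direction_changes_insert_Cons[OF this(1,2)] Cons.IH[OF this(3)]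
  show ?case
  proof (cases w)
    case Nil
    show ?thesis unfolding step Let_def unfolding Nil
      by (cases d; cases "b < e") (simp_all add: power2_eq_square algebra_simps)
  next
    case (Cons a v)
    show ?thesis unfolding step Let_def unfolding Cons
      by (cases d; cases "b < e"; cases "e < a") (simp_all add: power2_eq_square algebra_simps)
  qed
qed

text \<open>For the runs of a word with \<open>k\<close> runs, of the \<open>length w + 1\<close> places \<open>k\<close> leave the number of
  runs unchanged and two raise it by 1. The places before and directly after the first letter
  are treated by hand, since they affect the direction of the first step; the others are governed
  by the previous lemma.\<close>

lemma sum_num_runs_insert_max:
  fixes x :: "'a::comm_ring_1"
  assumes "distinct w" "\<forall>a\<in>set w. a < M" "w \<noteq> []"
  shows "(\<Sum>p\<le>length w. x ^ num_runs (take p w @ M # drop p w)) =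
    (let k = num_runs w in
      of_nat k * x ^ k + 2 * x ^ (k + 1) + (of_nat (length w) - 1 - of_nat k) * x ^ (k + 2))"
proof (cases w)
  case (Cons a u)
  show ?thesis
  proof (cases u)
    case Nil
    then show ?thesis using Cons assms
      by (simp add: num_runs_Cons_Cons num_runs_singleton)
  next
    case (Cons b v)
    have w: "w = a # b # v" using Cons \<open>w = a # u\<close> by simp
    let ?c = "direction_changes (a < b) (b # v)"
    have less: "a < M" "b < M" using assms w by auto
    have "num_runs (M # a # b # v) = Suc (direction_changes False (a # b # v))"
      using assms less unfolding w by (subst num_runs_Cons_Cons) auto
    moreover have "num_runs (a # M # b # v) = Suc (Suc (direction_changes False (b # v)))"
      using assms less unfolding w by (subst num_runs_Cons_Cons) auto
    moreover have "num_runs (a # b # take p v @ M # drop p v) =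
        Suc (direction_changes (a < b) (b # take p v @ M # drop p v))" for p
      using assms unfolding w
      by (intro num_runs_Cons_Cons)
        (auto dest: in_set_takeD in_set_dropD simp: set_take_disj_set_drop_if_distinct)
    ultimately have "(\<Sum>p\<le>length w. x ^ num_runs (take p w @ M # drop p w)) =
      x ^ Suc (direction_changes False (a # b # v)) + x ^ Suc (Suc (direction_changes False (b # v)))
      + x * (\<Sum>p\<le>length v. x ^ direction_changes (a < b) (b # take p v @ M # drop p v))"
      unfolding w
      by (simp add: sum.atMost_Suc_shift sum_distrib_left add.assoc del: sum.atMost_Suc)
    also have "\<dots> = of_nat (Suc ?c) * x ^ Suc ?c + 2 * x ^ (Suc ?c + 1)
      + (of_nat (length w) - 1 - of_nat (Suc ?c)) * x ^ (Suc ?c + 2)"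
    proof -
      have "\<forall>e\<in>set (b # v). e < M" using assms w by auto
      note ins = sum_direction_changes_insert_max[OF this]
      show ?thesis
      proof (cases v)
        case Nil
        show ?thesis unfolding ins Let_def w unfolding Nil
          by (cases "a < b") (simp_all add: power2_eq_square algebra_simps)
      next
        case (Cons e u)
        show ?thesis unfolding ins Let_def w unfolding Cons
          by (cases "a < b"; cases "b < e") (simp_all add: power2_eq_square algebra_simps)
      qed
    qed
    also have "Suc ?c = num_runs w"
      using assms unfolding w by (simp only: num_runs_Cons_Cons)
    finally show ?thesis by (simp only: Let_def)
  qed
qed (use assms in simp)

text \<open>Every permutation of a set with one more element \<open>x\<close> arises from exactly one permutation of
  the old set and one place for \<open>x\<close>: delete \<open>x\<close>, and read off how many letters precede it.\<close>

lemma sum_permutations_of_set_insert: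
  assumes "finite A" "x \<notin> A"
  shows "(\<Sum>v\<in>permutations_of_set (insert x A). f v) =
    (\<Sum>w\<in>permutations_of_set A. \<Sum>p\<le>card A. f (take p w @ x # drop p w))"
proof -
  let ?ins = "\<lambda>(w, p). take p w @ x # drop p w"
  have split_x: "\<exists>ys zs. v = ys @ x # zs \<and> x \<notin> set ys \<and> x \<notin> set zs \<and> distinct (ys @ zs)
      \<and> set (ys @ zs) = A \<and> length (ys @ zs) = card A"
    if v: "v \<in> permutations_of_set (insert x A)" for v
  proof -
    have "set v = insert x A" "distinct v" using v by (auto simp: permutations_of_set_def)
    then obtain ys zs where v_eq: "v = ys @ x # zs" by (metis insertI1 split_list)
    then have "distinct (ys @ zs)" "set (ys @ zs) = A" "x \<notin> set ys" "x \<notin> set zs"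
      using \<open>set v = _\<close> \<open>distinct v\<close> assms(2) by auto
    then show ?thesis using v_eq distinct_card by metis
  qed
  have "bij_betw ?ins (permutations_of_set A \<times> {..card A}) (permutations_of_set (insert x A))"
  proof (rule bij_betwI[where g = "\<lambda>v. (removeAll x v, length (takeWhile (\<lambda>y. y \<noteq> x) v))"])
    show "?ins \<in> permutations_of_set A \<times> {..card A} \<rightarrow> permutations_of_set (insert x A)"
    proof clarify
      fix w p assume w: "w \<in> permutations_of_set A"
      have "set (take p w) \<union> set (drop p w) = A"
        using w by (metis append_take_drop_id permutations_of_setD(1) set_append)
      then show "take p w @ x # drop p w \<in> permutations_of_set (insert x A)"
        using w assms by (auto simp: permutations_of_set_def set_take_disj_set_drop_if_distinct)
    qed
    show "(\<lambda>v. (removeAll x v, length (takeWhile (\<lambda>y. y \<noteq> x) v)))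
      \<in> permutations_of_set (insert x A) \<rightarrow> permutations_of_set A \<times> {..card A}"
      by (rule funcsetI, drule split_x) (auto simp: permutations_of_set_def takeWhile_append)
    show "(\<lambda>v. (removeAll x v, length (takeWhile (\<lambda>y. y \<noteq> x) v))) (?ins q) = q"
      if q: "q \<in> permutations_of_set A \<times> {..card A}" for q
    proof -
      obtain w p where wp: "q = (w, p)" "w \<in> permutations_of_set A" "p \<le> card A"
        using q by auto
      then have "x \<notin> set w" "length w = card A"
        using assms by (auto simp: permutations_of_set_def distinct_card)
      then have "x \<notin> set (take p w)" "x \<notin> set (drop p w)"
        by (auto dest: in_set_takeD in_set_dropD)
      then show ?thesis using wp \<open>length w = _\<close>
        by (auto simp: takeWhile_append)
    qed
    show "?ins (removeAll x v, length (takeWhile (\<lambda>y. y \<noteq> x) v)) = v"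
      if "v \<in> permutations_of_set (insert x A)" for v
      using split_x[OF that] by (auto simp: takeWhile_append)
  qed
  from sum.reindex_bij_betw[OF this, of f] show ?thesis
    by (simp add: sum.cartesian_product split_def)
qed

section \<open>The derivation behind the recurrences\<close>

text \<open>The value \<open>D x = x * (1 - x\<^sup>2)\<close> is chosen so that \<open>D (x ^ k) = k * (x ^ k - x ^ (k + 2))\<close>.
  Suppose that an insertion turned a weight \<open>x ^ k\<close> into \<open>x ^ (k + 2)\<close> at every place; adding \<open>D (x ^ k)\<close>
  corrects this to \<open>x ^ k\<close> at \<open>k\<close> of the places, which are the ones that keep the count. Since
  only the product rule and the value at \<open>x\<close> matter, the setting is an abstract commutative ring; it is
  used for integer polynomials with \<open>D p = x * (1 - x\<^sup>2) * p'\<close>.\<close>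

locale alternating_run_derivation =
  fixes D :: "'a::comm_ring_1 \<Rightarrow> 'a" and x :: 'a
  assumes D_add: "D (p + q) = D p + D q"
    and D_mult: "D (p * q) = D p * q + p * D q"
    and D_x: "D x = x * (1 - x\<^sup>2)"
begin

lemma D_zero: "D 0 = 0"
  using D_add[of 0 0] by simp

lemma D_minus: "D (- p) = - D p"
  using D_add[of p "- p"] by (simp add: D_zero eq_neg_iff_add_eq_0 add.commute)

lemma D_one: "D 1 = 0"
  using D_mult[of 1 1] by simp

lemma D_of_nat: "D (of_nat m) = 0"
  by (induction m) (simp_all add: D_zero D_one D_add)

lemma D_sum: "D (sum f A) = (\<Sum>i\<in>A. D (f i))"
  by (induction A rule: infinite_finite_induct) (simp_all add: D_zero D_add)

lemma D_x_power: "D (x ^ c) = of_nat c * (x ^ c - x ^ (c + 2))"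
proof (induction c)
  case (Suc c)
  show ?case
    unfolding power_Suc D_mult D_x Suc.IH by (simp add: algebra_simps power2_eq_square)
qed (simp add: D_one)

lemma D_one_minus_x2: "D (1 - x\<^sup>2) = - 2 * x\<^sup>2 * (1 - x\<^sup>2)"
proof -
  have "D (1 - x\<^sup>2) = - D (x\<^sup>2)"
    using D_add[of 1 "- x\<^sup>2"] by (simp add: D_one D_minus)
  moreover have "D (x\<^sup>2) = 2 * x\<^sup>2 * (1 - x\<^sup>2)"
    using D_mult[of x x] by (simp add: D_x algebra_simps power2_eq_square)
  ultimately show ?thesis by simp
qed

lemma D_one_minus_x2_power: "D ((1 - x\<^sup>2) ^ m) = - 2 * of_nat m * x\<^sup>2 * (1 - x\<^sup>2) ^ m"
proof (induction m)
  case (Suc m)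
  have "D ((1 - x\<^sup>2) ^ Suc m) = (- 2 * x\<^sup>2 * (1 - x\<^sup>2)) * (1 - x\<^sup>2) ^ m
     + (1 - x\<^sup>2) * (- 2 * of_nat m * x\<^sup>2 * (1 - x\<^sup>2) ^ m)"
    unfolding power_Suc D_mult D_one_minus_x2 Suc.IH ..
  also have "\<dots> = - 2 * of_nat (Suc m) * x\<^sup>2 * (1 - x\<^sup>2) ^ Suc m"
    by (simp add: algebra_simps)
  finally show ?case .
qed (simp add: D_one)

lemma D_sign: "D ((- 1) ^ k * p) = (- 1) ^ k * D p"
  by (cases "even k") (simp_all add: D_minus)

text \<open>The hypothesis holds for \<open>p = 1 + x\<close> with \<open>l = x - x\<^sup>2\<close> and for \<open>p = x - 1\<close> with
  \<open>l = - x - x\<^sup>2\<close>. As \<open>D\<close> multiplies \<open>1 - x\<^sup>2\<close> by \<open>- 2 * x\<^sup>2\<close>, it multiplies \<open>u n\<close> by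
  \<open>l - 2 * m * x\<^sup>2\<close> with \<open>m = (n - 1) div 2\<close>. What remains of the coefficient of \<open>u n\<close> on the right is
  \<open>(n - 1 - 2 * m) * x\<^sup>2 - 1\<close>, which is \<open>-1\<close> for odd \<open>n\<close> and \<open>- (1 - x\<^sup>2)\<close> for even \<open>n\<close>; and this is
  the ratio of consecutive terms.\<close>

lemma signed_power_recurrence:
  assumes "D p = l * p" "1 \<le> n"
    and u: "\<And>m. u m = (- 1) ^ (m + 1) * p * (1 - x\<^sup>2) ^ ((m - 1) div 2)"
  shows "u (Suc n) = (of_nat n * x\<^sup>2 - x\<^sup>2 - 1 - l) * u n + D (u n)"
proof -
  define m where "m = (n - 1) div 2"
  define e :: 'a where "e = (- 1) ^ (n + 1)"
  define c where "c = (1 - x\<^sup>2) ^ m"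
  have un: "u n = e * p * c" by (simp add: u e_def c_def m_def)
  have "D (u n) = e * (D p * c + p * D c)"
    unfolding un e_def mult.assoc D_sign D_mult[of p] ..
  then have Du: "D (u n) = (l - 2 * of_nat m * x\<^sup>2) * u n"
    unfolding c_def D_one_minus_x2_power assms(1) unfolding un c_def by (simp add: algebra_simps)
  consider "n = 2 * m + 1" | "n = 2 * m + 2"
    using \<open>1 \<le> n\<close> unfolding m_def by linarith
  then show ?thesis
  proof cases
    case 1
    then have "u (Suc n) = - u n" unfolding un by (simp add: u e_def c_def)
    then show ?thesis unfolding Du by (simp add: 1 algebra_simps)
  next
    case 2
    then have "u (Suc n) = - (1 - x\<^sup>2) * u n"
      unfolding un by (simp add: u e_def c_def algebra_simps)
    then show ?thesis unfolding Du by (simp add: 2 algebra_simps)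
  qed
qed

lemma sum_direction_changes_insert_max_eq_derivation:
  assumes "\<forall>a\<in>set (b # w). a < M"
  shows "(\<Sum>p\<le>length w. x ^ direction_changes False (b # take p w @ M # drop p w)) =
    (of_nat (length w) * x\<^sup>2 + x) * x ^ direction_changes False (b # w)
      + D (x ^ direction_changes False (b # w))"
  unfolding sum_direction_changes_insert_max[OF assms] D_x_power Let_def
  by (simp add: algebra_simps power2_eq_square)

lemma sum_num_runs_insert_max_eq_derivation:
  assumes "distinct w" "\<forall>a\<in>set w. a < M" "w \<noteq> []"
  shows "(\<Sum>p\<le>length w. x ^ num_runs (take p w @ M # drop p w)) =
    (of_nat (length w - 1) * x\<^sup>2 + 2 * x) * x ^ num_runs w + D (x ^ num_runs w)"
  unfolding sum_num_runs_insert_max[OF assms] D_x_power Let_def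
  using \<open>w \<noteq> []\<close> by (simp add: algebra_simps power2_eq_square Suc_le_eq)

end

lemma sum_binomial_Suc:
  fixes h :: "nat \<Rightarrow> 'a::comm_semiring_1"
  shows "(\<Sum>k\<le>n. of_nat (Suc n choose k) * h k) =
    (\<Sum>k\<le>n. of_nat (n choose k) * h k) + (\<Sum>k<n. of_nat (n choose k) * h (Suc k))"
  unfolding lessThan_Suc_atMost[symmetric] sum.lessThan_Suc_shift
  by (simp add: sum.distrib algebra_simps)

text \<open>The first-order recurrence of \<open>f\<close> turns into a convolution with \<open>s\<close>. Let \<open>F\<close> be the
  exponential generating function of \<open>f\<close>, and \<open>S\<close> and \<open>T\<close> those of \<open>s\<close> and \<open>t\<close> without constant terms.
  The hypotheses are linear differential equations in which \<open>D\<close> acts on the coefficients, and the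
  claim is \<open>F = (f 0 + T) / (1 - S)\<close>, which solves the equation of \<open>F\<close> because of those of \<open>S\<close>
  and \<open>T\<close>.

  Written out for coefficients, the induction step applies \<open>D\<close> to the convolution for \<open>n\<close>. The
  product rule and the recurrences yield the products \<open>s (n + 1 - k) * f k\<close> and
  \<open>s (n - k) * f (k + 1)\<close>, which Pascal's rule combines to the convolution for \<open>n + 1\<close>. The terms
  in \<open>y\<close> cancel because \<open>n = (n - k) + k\<close>, and the terms with the factor \<open>c\<close> add up to
  \<open>c * f n = s 1 * f n\<close>, which is the first of these products for \<open>k = n\<close>.\<close>

lemma (in alternating_run_derivation) binomial_convolution_of_derivation_recurrence:
  assumes f: "\<And>m. f (Suc m) = (of_nat m * y + b) * f m + D (f m)"
    and s: "\<And>m. 1 \<le> m \<Longrightarrow> s (Suc m) = (of_nat m * y - c) * s m + D (s m)"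
    and t: "\<And>m. 1 \<le> m \<Longrightarrow> t (Suc m) = (of_nat m * y + b - c) * t m + D (t m)"
    and s1: "s 1 = c"
    and f1: "f 1 = t 1 + s 1 * f 0"
    and "1 \<le> n"
  shows "f n = t n + (\<Sum>k<n. of_nat (n choose k) * s (n - k) * f k)"
  using \<open>1 \<le> n\<close>
proof (induction n rule: nat_induct_at_least)
  case base
  then show ?case using f1 by simp
next
  case (Suc n)
  let ?C = "\<lambda>k. of_nat (n choose k) :: 'a"
  have summand: "(of_nat n * y + b) * (?C k * s (n - k) * f k) + D (?C k * s (n - k) * f k)
    = ?C k * (s (Suc n - k) * f k) + ?C k * (s (n - k) * f (Suc k)) + c * (?C k * s (n - k) * f k)"
    if "k < n" for k
  proof -
    define m where "m = n - k"
    have m: "1 \<le> m" "n = m + k" "Suc n - k = Suc m" "n - k = m" using that by (auto simp: m_def)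
    have Ds: "D (s m) = s (Suc m) - (of_nat m * y - c) * s m" using s[OF m(1)] by simp
    have Df: "D (f k) = f (Suc k) - (of_nat k * y + b) * f k" using f[of k] by simp
    show ?thesis
      unfolding m(3,4) D_mult D_of_nat Ds Df unfolding m(2) by (simp add: algebra_simps)
  qed
  have "f (Suc n) = (of_nat n * y + b) * (t n + (\<Sum>k<n. ?C k * s (n - k) * f k))
      + D (t n + (\<Sum>k<n. ?C k * s (n - k) * f k))"
    unfolding f[of n] Suc.IH[symmetric] by simp
  also have "\<dots> = (of_nat n * y + b) * t n + D (t n)
     + (\<Sum>k<n. (of_nat n * y + b) * (?C k * s (n - k) * f k) + D (?C k * s (n - k) * f k))"
    unfolding D_add D_sum distrib_left[of _ "t n"] sum_distrib_left sum.distrib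
    by (simp only: add_ac)
  also have "(of_nat n * y + b) * t n + D (t n) = t (Suc n) + c * t n"
    using t[OF Suc.hyps] by (simp add: algebra_simps)
  also have "(\<Sum>k<n. (of_nat n * y + b) * (?C k * s (n - k) * f k) + D (?C k * s (n - k) * f k))
    = (\<Sum>k<n. ?C k * (s (Suc n - k) * f k)) + (\<Sum>k<n. ?C k * (s (n - k) * f (Suc k)))
      + c * (\<Sum>k<n. ?C k * s (n - k) * f k)"
    by (simp add: summand sum.distrib sum_distrib_left)
  also have "t (Suc n) + c * t n + \<dots> = t (Suc n) + (\<Sum>k<n. ?C k * (s (Suc n - k) * f k))
     + (\<Sum>k<n. ?C k * (s (n - k) * f (Suc k))) + c * (t n + (\<Sum>k<n. ?C k * s (n - k) * f k))"
    by (simp add: algebra_simps)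
  also have "\<dots> = t (Suc n) + ((\<Sum>k\<le>n. ?C k * (s (Suc n - k) * f k))
     + (\<Sum>k<n. ?C k * (s (n - k) * f (Suc k))))"
    unfolding Suc.IH[symmetric] using s1
    by (simp add: lessThan_Suc_atMost[symmetric] algebra_simps)
  also have "\<dots> = t (Suc n) + (\<Sum>k\<le>n. of_nat (Suc n choose k) * (s (Suc n - k) * f k))"
    by (subst sum_binomial_Suc) simp
  finally show ?case by (simp add: lessThan_Suc_atMost mult.assoc)
qed

section \<open>Recurrences for the polynomials\<close>

interpretation run_deriv: alternating_run_derivation "\<lambda>p. X * (1 - X\<^sup>2) * pderiv p" X
  by unfold_locales (simp_all only: pderiv_add pderiv_mult pderiv_pCons pderiv_1 pderiv_0 algebra_simps, simp_all)

lemma s_poly_Suc: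
  assumes "1 \<le> n"
  shows "s_poly (Suc n) = (of_nat n * X\<^sup>2 - (1 + X)) * s_poly n + X * (1 - X\<^sup>2) * pderiv (s_poly n)"
proof -
  have "X * (1 - X\<^sup>2) * pderiv (1 + X) = (X - X\<^sup>2) * (1 + X)"
    by (simp add: pderiv_add pderiv_pCons power2_eq_square one_pCons)
  from run_deriv.signed_power_recurrence[OF this assms, of s_poly]
  show ?thesis by (simp only: s_poly_def refl) (simp only: algebra_simps)
qed

lemma r_poly_Suc:
  assumes "1 \<le> n"
  shows "r_poly (Suc n) = (of_nat n * X\<^sup>2 + 2 * X - (1 + X)) * r_poly n + X * (1 - X\<^sup>2) * pderiv (r_poly n)"
proof -
  have p: "X * (1 - X\<^sup>2) * pderiv (X - 1) = (- X - X\<^sup>2) * (X - 1)"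
    by (simp add: pderiv_diff pderiv_pCons power2_eq_square one_pCons)
  define u where "u m = (- 1) ^ (m + 1) * (X - 1) * (1 - X\<^sup>2) ^ ((m - 1) div 2)" for m
  \<comment> \<open>The two signs differ at \<open>m = 0\<close>, where \<open>m - 1\<close> truncates.\<close>
  have r: "r_poly m = u m" if "1 \<le> m" for m
    using that by (cases m) (simp_all only: r_poly_def u_def, simp_all)
  have rS: "r_poly (Suc n) = u (Suc n)" by (rule r) simp
  have step: "u (Suc n) = (of_nat n * X\<^sup>2 - X\<^sup>2 - 1 - (- X - X\<^sup>2)) * u n + X * (1 - X\<^sup>2) * pderiv (u n)"
    by (rule run_deriv.signed_power_recurrence[OF p assms u_def])
  have coeff: "of_nat n * X\<^sup>2 - X\<^sup>2 - 1 - (- X - X\<^sup>2) = of_nat n * X\<^sup>2 + 2 * X - (1 + X)"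
    by (simp only: algebra_simps mult_2)
  show ?thesis
    unfolding rS r[OF assms] by (rule step[unfolded coeff])
qed

lemma monom_1_eq_X_power: "monom 1 c = X ^ c"
  by (simp add: monom_altdef)

lemma sum_permutations_insert_last:
  "(\<Sum>v\<in>permutations_of_set {1..Suc n}. f v) =
    (\<Sum>w\<in>permutations_of_set {1..n}. \<Sum>p\<le>length w. f (take p w @ Suc n # drop p w))"
proof -
  have "length w = n" if "w \<in> permutations_of_set {1..n}" for w
    using that by (auto simp: permutations_of_set_def dest: distinct_card)
  then show ?thesis
    using sum_permutations_of_set_insert[of "{1..n}" "Suc n" f]
    by (simp add: atLeastAtMostSuc_conv)
qed

lemma up_down_run_poly_Suc:
  "up_down_run_poly (Suc n) = (of_nat n * X\<^sup>2 + X) * up_down_run_poly n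
    + X * (1 - X\<^sup>2) * pderiv (up_down_run_poly n)"
proof -
  have "(\<Sum>p\<le>length w. X ^ up_down_runs (take p w @ Suc n # drop p w)) =
      (of_nat n * X\<^sup>2 + X) * X ^ up_down_runs w + X * (1 - X\<^sup>2) * pderiv (X ^ up_down_runs w)"
    if "w \<in> permutations_of_set {1..n}" for w
  proof -
    have w: "distinct w" "set w = {1..n}" using that by (auto simp: permutations_of_set_def)
    then have len: "length w = n" using distinct_card by fastforce
    have ins: "up_down_runs (take p w @ Suc n # drop p w) =
        direction_changes False (0 # take p w @ Suc n # drop p w)" for p
      using w by (intro up_down_runs_eq_direction_changes)
        (auto simp: set_take_disj_set_drop_if_distinct dest!: in_set_takeD in_set_dropD)
    have ud: "up_down_runs w = direction_changes False (0 # w)"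
      using w by (intro up_down_runs_eq_direction_changes) auto
    have "\<forall>a\<in>set (0 # w). a < Suc n" using w by auto
    from run_deriv.sum_direction_changes_insert_max_eq_derivation[OF this]
    show ?thesis unfolding ins ud len .
  qed
  then show ?thesis
    unfolding up_down_run_poly_def monom_1_eq_X_power sum_permutations_insert_last run_deriv.D_sum
      sum_distrib_left[of "of_nat n * X\<^sup>2 + X"] sum.distrib[symmetric]
    by (rule sum.cong[OF refl])
qed

lemma run_poly_Suc_Suc:
  "run_poly (Suc (Suc n)) = (of_nat n * X\<^sup>2 + 2 * X) * run_poly (Suc n)
    + X * (1 - X\<^sup>2) * pderiv (run_poly (Suc n))"
proof -
  have "(\<Sum>p\<le>length w. X ^ num_runs (take p w @ Suc (Suc n) # drop p w)) =
      (of_nat n * X\<^sup>2 + 2 * X) * X ^ num_runs w + X * (1 - X\<^sup>2) * pderiv (X ^ num_runs w)"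
    if "w \<in> permutations_of_set {1..Suc n}" for w
  proof -
    have w: "distinct w" "set w = {1..Suc n}" using that by (auto simp: permutations_of_set_def)
    then have "length w = Suc n" using distinct_card by fastforce
    then have len: "length w - 1 = n" by simp
    have "\<forall>a\<in>set w. a < Suc (Suc n)" "w \<noteq> []" using w by auto
    from run_deriv.sum_num_runs_insert_max_eq_derivation[OF w(1) this] show ?thesis
      unfolding len .
  qed
  then show ?thesis
    unfolding run_poly_def monom_1_eq_X_power sum_permutations_insert_last[of _ "Suc n"]
      run_deriv.D_sum sum_distrib_left[of "of_nat n * X\<^sup>2 + 2 * X"] sum.distrib[symmetric]
    by (rule sum.cong[OF refl])
qed

lemma up_down_run_poly_1: "up_down_run_poly (Suc 0) = X"
proof -
  have "up_down_run_poly 0 = 1"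
    by (simp add: up_down_run_poly_def up_down_runs_def num_runs_singleton)
  then show ?thesis using up_down_run_poly_Suc[of 0] by simp
qed

lemma run_poly_1: "run_poly (Suc 0) = 1"
  by (simp add: run_poly_def permutations_of_set_singleton num_runs_singleton)

lemma s_poly_1: "s_poly 1 = 1 + X"
  by (simp add: s_poly_def)

lemma r_poly_1: "r_poly 1 = X - 1"
  by (simp add: r_poly_def)

text \<open>The families enter the convolution lemma with their index shifted by one, as
  \<open>f n = S\<^sub>n\<^sub>+\<^sub>1\<close> and \<open>f n = R\<^sub>n\<^sub>+\<^sub>1\<close>. The starting condition \<open>f 1 = t 1 + s 1 * f 0\<close> then forces the
  inhomogeneous part \<open>t\<close>: it gives \<open>t 1 = 0\<close> for \<open>S\<close>, and for \<open>R\<close> it gives \<open>t 1 = X - 1\<close>, the value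
  of \<open>r\<^sub>1\<close>.\<close>

lemma up_down_run_poly_convolution:
  assumes "1 \<le> n"
  shows "up_down_run_poly (Suc n) =
    (\<Sum>k<n. of_nat (n choose k) * s_poly (n - k) * up_down_run_poly (Suc k))"
proof -
  have "up_down_run_poly (Suc n) =
    0 + (\<Sum>k<n. of_nat (n choose k) * s_poly (n - k) * up_down_run_poly (Suc k))"
  proof (rule run_deriv.binomial_convolution_of_derivation_recurrence[where t = "\<lambda>_. 0"
      and f = "\<lambda>n. up_down_run_poly (Suc n)" and y = "X\<^sup>2" and b = "X\<^sup>2 + X" and c = "1 + X"])
    show "up_down_run_poly (Suc (Suc m)) = (of_nat m * X\<^sup>2 + (X\<^sup>2 + X)) * up_down_run_poly (Suc m)
      + X * (1 - X\<^sup>2) * pderiv (up_down_run_poly (Suc m))" for m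
      by (simp only: up_down_run_poly_Suc[of "Suc m"] of_nat_Suc algebra_simps mult_1_left)
    have "up_down_run_poly (Suc 1) = X * (1 + X)"
      by (simp add: up_down_run_poly_Suc[of "Suc 0"] up_down_run_poly_1 pderiv_pCons
         power2_eq_square one_pCons)
    then show "up_down_run_poly (Suc 1) = 0 + s_poly 1 * up_down_run_poly (Suc 0)"
      by (simp only: s_poly_1 up_down_run_poly_1 mult.commute add_0)
  qed (use assms s_poly_Suc s_poly_1 in simp_all)
  then show ?thesis by simp
qed

lemma run_poly_convolution:
  assumes "1 \<le> n"
  shows "run_poly (Suc n) =
    r_poly n + (\<Sum>k<n. of_nat (n choose k) * s_poly (n - k) * run_poly (Suc k))"
proof (rule run_deriv.binomial_convolution_of_derivation_recurrence[
      where f = "\<lambda>n. run_poly (Suc n)" and y = "X\<^sup>2" and b = "2 * X" and c = "1 + X"])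
  show "run_poly (Suc 1) = r_poly 1 + s_poly 1 * run_poly (Suc 0)"
    by (simp add: run_poly_Suc_Suc[of 0] run_poly_1 s_poly_1[unfolded One_nat_def] r_poly_1[unfolded One_nat_def]
      numeral_poly)
qed (fact run_poly_Suc_Suc s_poly_Suc r_poly_Suc s_poly_1 assms)+

section \<open>Lower Hessenberg determinants\<close>

text \<open>Allowing an arbitrary last row \<open>b\<close> makes induction possible: the last column has only the
  entries \<open>-1\<close> and \<open>b n\<close>. Deleting the row of the \<open>-1\<close> leaves a smaller matrix of the same shape, again
  with last row \<open>b\<close>, and the sign of its cofactor cancels that of the \<open>-1\<close>.\<close>

lemma det_lower_hessenberg_last_row:
  fixes a :: "nat \<Rightarrow> nat \<Rightarrow> 'a::comm_ring_1"
  assumes "\<And>i. a i (Suc i) = - 1" "\<And>i j. Suc i < j \<Longrightarrow> a i j = 0"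
  shows "det (mat (Suc n) (Suc n) (\<lambda>(i, j). if i = n then b j else a i j)) =
    (\<Sum>k\<le>n. b k * det (mat k k (\<lambda>(i, j). a i j)))"
proof (induction n)
  case 0
  show ?case by (simp add: det_single)
next
  case (Suc n)
  let ?A = "mat (Suc (Suc n)) (Suc (Suc n)) (\<lambda>(i, j). if i = Suc n then b j else a i j)"
  have "det ?A = (\<Sum>i<Suc (Suc n). ?A $$ (i, Suc n) * cofactor ?A i (Suc n))"
    by (rule laplace_expansion_column) auto
  also have "\<dots> = ?A $$ (n, Suc n) * cofactor ?A n (Suc n)
      + ?A $$ (Suc n, Suc n) * cofactor ?A (Suc n) (Suc n)"
    by (simp add: assms)
  also have "mat_delete ?A n (Suc n) = mat (Suc n) (Suc n) (\<lambda>(i, j). if i = n then b j else a i j)"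
    by (rule eq_matI) (auto simp: mat_delete_def)
  then have "cofactor ?A n (Suc n) = - (\<Sum>k\<le>n. b k * det (mat k k (\<lambda>(i, j). a i j)))"
    by (simp add: cofactor_def Suc.IH)
  also have "mat_delete ?A (Suc n) (Suc n) = mat (Suc n) (Suc n) (\<lambda>(i, j). a i j)"
    by (rule eq_matI) (auto simp: mat_delete_def)
  then have "cofactor ?A (Suc n) (Suc n) = det (mat (Suc n) (Suc n) (\<lambda>(i, j). a i j))"
    by (simp add: cofactor_def)
  finally show ?case by (simp add: assms)
qed

lemma det_lower_hessenberg_Suc:
  fixes a :: "nat \<Rightarrow> nat \<Rightarrow> 'a::comm_ring_1"
  assumes "\<And>i. a i (Suc i) = - 1" "\<And>i j. Suc i < j \<Longrightarrow> a i j = 0"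
  shows "det (mat (Suc n) (Suc n) (\<lambda>(i, j). a i j)) =
    (\<Sum>k\<le>n. a n k * det (mat k k (\<lambda>(i, j). a i j)))"
proof -
  have "(\<lambda>(i, j). a i j) = (\<lambda>(i, j). if i = n then a n j else a i j)"
    by (auto simp: fun_eq_iff)
  then show ?thesis
    using det_lower_hessenberg_last_row[where a = a and b = "a n", OF assms] by simp
qed

theorem theorem11:
  fixes n :: nat
  assumes "n \<ge> 1"
  shows "up_down_run_poly (n + 1) = det (mat n n (\<lambda>(i, j). m_entry (i + 1) (j + 1)))
    \<and> run_poly (n + 1) = det (mat (n + 1) (n + 1) (\<lambda>(i, j). p_entry i j))"
proof
  let ?M = "\<lambda>k. det (mat k k (\<lambda>(i, j). m_entry (i + 1) (j + 1)))"
  let ?P = "\<lambda>k. det (mat k k (\<lambda>(i, j). p_entry i j))"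
  have M_Suc: "?M (Suc k) = (\<Sum>j\<le>k. m_entry (k + 1) (j + 1) * ?M j)" for k
    by (rule det_lower_hessenberg_Suc) (simp_all add: m_entry_def)
  have P_Suc: "?P (Suc k) = (\<Sum>j\<le>k. p_entry k j * ?P j)" for k
    by (rule det_lower_hessenberg_Suc) (simp_all add: p_entry_def)
  show "up_down_run_poly (n + 1) = ?M n"
    using assms
  proof (induction n rule: less_induct)
    case (less n)
    then obtain k where n: "n = Suc k" by (cases n) auto
    have "m_entry (k + 1) (j + 1) * ?M j =
      of_nat (n choose j) * s_poly (n - j) * up_down_run_poly (Suc j)" if "j \<le> k" for j
    proof (cases j)
      case 0
      then show ?thesis by (simp only: m_entry_def n up_down_run_poly_1) simp
    next
      case (Suc i)
      then have "?M j = up_down_run_poly (Suc j)" using less.IH[of j] that n by simp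
      then show ?thesis using Suc that n by (simp only: m_entry_def) simp
    qed
    then show ?case
      unfolding n M_Suc using up_down_run_poly_convolution[of "Suc k"] n
      by (simp add: lessThan_Suc_atMost)
  qed
  show "run_poly (n + 1) = ?P (n + 1)"
  proof (induction n rule: less_induct)
    case (less n)
    show ?case
    proof (cases n)
      case 0
      then show ?thesis by (simp add: det_single p_entry_def run_poly_1)
    next
      case (Suc k)
      have "?P (Suc n) = p_entry n 0 * ?P 0 + (\<Sum>j<n. p_entry n (Suc j) * ?P (Suc j))"
        unfolding P_Suc[of n] lessThan_Suc_atMost[symmetric] by (rule sum.lessThan_Suc_shift)
      also have "(\<Sum>j<n. p_entry n (Suc j) * ?P (Suc j)) =
        (\<Sum>j<n. of_nat (n choose j) * s_poly (n - j) * run_poly (Suc j))"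
        using less.IH by (intro sum.cong) (simp_all add: p_entry_def)
      also have "p_entry n 0 * ?P 0 = r_poly n"
        using Suc by (simp add: p_entry_def)
      finally show ?thesis
        using run_poly_convolution[of n] Suc by simp
    qed
  qed
qed

end
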